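(* Let $\mathsf{V}=(\mathsf{V},\otimes,k)$ be a commutative quantale. Given a $\mathsf{V}$-category $A$ and a complete $\mathsf{V}$-category $X$, define, for $a\in A$, $x\in X$, the $\mathsf{V}$-functors $$\iota(a,x)\colon A^{\mathrm{op}}\to X,\ \iota(a,x)b=A(b,a)\star x,\qquad \iota^{\dagger}(a,x)\colon A\to X,\ \iota^{\dagger}(a,x)b=A(a,b)\star x,$$ where $\star$ denotes tensors in $X$. Then $$X^{A^{\mathrm{op}}}(\iota(a,x),\mu)=X(x,\mu a)\quad\text{and}\quad(X^A)^{\mathrm{op}}(\lambda,\iota^{\dagger}(a,x))=X(x,\lambda a)$$ for all $a\in A$, $x\in X$, $\mu\in X^{A^{\mathrm{op}}}$, $\lambda\in X^A$.
   Context: A commutative quantale is a commutative monoid $(\mathsf{V},\otimes,k)$ whose underlying set is a complete lattice with $x\otimes\bigvee_i y_i=\bigvee_i x\otimes y_i$; the implication $\to$ is defined by $x\otimes y\leq z\iff x\leq y\to z$. A $\mathsf{V}$-category is a set $X$ with a map $X(-,-)\colon X\times X\to\mathsf{V}$ such that $k\leq X(x,x)$ and $X(x,y)\otimes X(y,z)\leq X(x,z)$. Its underlying preorder is $x\leq y\iff k\leq X(x,y)$; $x\cong y$ means $x\leq y$ and $y\leq x$. A $\mathsf{V}$-functor $f\colon X\to Y$ is a map with $X(x,y)\leq Y(fx,fy)$. $\mathsf{V}$ is a $\mathsf{V}$-category via $\mathsf{V}(x,y)=x\to y$. $X^{\mathrm{op}}$ has the same objects with $X^{\mathrm{op}}(x,y)=X(y,x)$.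 $Y^X$ is the $\mathsf{V}$-category of $\mathsf{V}$-functors $X\to Y$ with $Y^X(f,g)=\bigwedge_{x\in X}Y(fx,gx)$. An infimum of $\lambda\in\mathsf{V}^X$ is an object $\inf\lambda\in X$ with $X(x,\inf\lambda)=\bigwedge_{y\in X}\lambda y\to X(x,y)$ for all $x\in X$; $X$ is complete if every $\lambda\in\mathsf{V}^X$ has an infimum. The tensor of $v\in\mathsf{V}$ and $x\in X$ is an object $v\star x\in X$ (determined up to $\cong$; a choice is fixed) with $X(v\star x,y)=v\to X(x,y)$ for all $y\in X$; all tensors exist in a complete $\mathsf{V}$-category. *)

theory Defs
  imports Main "HOL-Library.FuncSet"
begin

text \<open>A commutative quantale, with \<open>*\<close> for the tensor and \<open>1\<close> for its unit \<open>k\<close>.\<close>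

class comm_quantale = complete_lattice + comm_monoid_mult +
  assumes mult_Sup: "x * Sup Y = (SUP y\<in>Y. x * y)"

definition qimp :: "'v::comm_quantale \<Rightarrow> 'v \<Rightarrow> 'v" (infixr "\<rightharpoonup>" 60)
  where "y \<rightharpoonup> z = Sup {x. x * y \<le> z}"

lemma qimp_adjoint:
  fixes x y z :: "'v::comm_quantale"
  shows "x * y \<le> z \<longleftrightarrow> x \<le> y \<rightharpoonup> z"
proof
  assume "x * y \<le> z"
  then show "x \<le> y \<rightharpoonup> z"
    unfolding qimp_def by (simp add: Sup_upper)
next
  assume le: "x \<le> y \<rightharpoonup> z"
  have mono: "y * u \<le> y * w" if "u \<le> w" for u w :: 'v
  proof -
    have "y * w = y * Sup {u, w}"
      using that by (simp add: sup_absorb2)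
    also have "\<dots> = sup (y * u) (y * w)"
      unfolding mult_Sup by simp
    finally show ?thesis
      by (metis sup_ge1)
  qed
  have "y * (y \<rightharpoonup> z) \<le> z"
    unfolding qimp_def mult_Sup by (rule SUP_least) (simp add: mult.commute)
  with mono[OF le] show "x * y \<le> z"
    by (simp add: mult.commute order_trans)
qed

record ('o, 'v) vcat =
  obj :: "'o set"
  hom :: "'o \<Rightarrow> 'o \<Rightarrow> 'v"

definition vcategory :: "('o, 'v::comm_quantale) vcat \<Rightarrow> bool"
  where "vcategory X \<longleftrightarrow>
    (\<forall>x\<in>obj X. 1 \<le> hom X x x) \<and>
    (\<forall>x\<in>obj X. \<forall>y\<in>obj X. \<forall>z\<in>obj X. hom X x y * hom X y z \<le> hom X x z)"

definition opp :: "('o, 'v) vcat \<Rightarrow> ('o, 'v) vcat"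
  where "opp X = \<lparr>obj = obj X, hom = (\<lambda>x y. hom X y x)\<rparr>"

definition self_vcat :: "('v, 'v::comm_quantale) vcat"
  where "self_vcat = \<lparr>obj = UNIV, hom = (\<rightharpoonup>)\<rparr>"

text \<open>Maps between object sets are extensional functions (equal to \<open>undefined\<close> outside
  the object set of the source), so that equality of functors is equality of functions.\<close>

definition vfunctors :: "('a, 'v::comm_quantale) vcat \<Rightarrow> ('b, 'v) vcat \<Rightarrow> ('a \<Rightarrow> 'b) set"
  where "vfunctors X Y =
    {f \<in> obj X \<rightarrow>\<^sub>E obj Y. \<forall>x\<in>obj X. \<forall>y\<in>obj X. hom X x y \<le> hom Y (f x) (f y)}"

text \<open>\<open>functor_vcat X Y\<close> is \<open>Y\<close> to the power \<open>X\<close>.\<close>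

definition functor_vcat ::
    "('a, 'v::comm_quantale) vcat \<Rightarrow> ('b, 'v) vcat \<Rightarrow> ('a \<Rightarrow> 'b, 'v) vcat"
  where "functor_vcat X Y =
    \<lparr>obj = vfunctors X Y, hom = (\<lambda>f g. INF x\<in>obj X. hom Y (f x) (g x))\<rparr>"

definition is_infimum :: "('o, 'v::comm_quantale) vcat \<Rightarrow> ('o \<Rightarrow> 'v) \<Rightarrow> 'o \<Rightarrow> bool"
  where "is_infimum X \<phi> i \<longleftrightarrow>
    i \<in> obj X \<and> (\<forall>x\<in>obj X. hom X x i = (INF y\<in>obj X. \<phi> y \<rightharpoonup> hom X x y))"

definition complete_vcategory :: "('o, 'v::comm_quantale) vcat \<Rightarrow> bool"
  where "complete_vcategory X \<longleftrightarrow>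
    vcategory X \<and> (\<forall>\<phi>\<in>obj (functor_vcat X self_vcat). \<exists>i. is_infimum X \<phi> i)"

definition is_tensor :: "('o, 'v::comm_quantale) vcat \<Rightarrow> 'v \<Rightarrow> 'o \<Rightarrow> 'o \<Rightarrow> bool"
  where "is_tensor X v x t \<longleftrightarrow>
    t \<in> obj X \<and> (\<forall>y\<in>obj X. hom X t y = v \<rightharpoonup> hom X x y)"

text \<open>Tensors are determined only up to isomorphism; the operator below fixes an arbitrary
  choice. It is meaningful whenever a tensor exists, in particular for every \<open>v\<close> and every
  object \<open>x\<close> of a complete category.\<close>

definition tensor :: "('o, 'v::comm_quantale) vcat \<Rightarrow> 'v \<Rightarrow> 'o \<Rightarrow> 'o"
  where "tensor X v x = (SOME t. is_tensor X v x t)"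

definition iota ::
    "('a, 'v::comm_quantale) vcat \<Rightarrow> ('x, 'v) vcat \<Rightarrow> 'a \<Rightarrow> 'x \<Rightarrow> 'a \<Rightarrow> 'x"
  where "iota A X a x = (\<lambda>b\<in>obj A. tensor X (hom A b a) x)"

definition iota_dagger ::
    "('a, 'v::comm_quantale) vcat \<Rightarrow> ('x, 'v) vcat \<Rightarrow> 'a \<Rightarrow> 'x \<Rightarrow> 'a \<Rightarrow> 'x"
  where "iota_dagger A X a x = (\<lambda>b\<in>obj A. tensor X (hom A a b) x)"

end

theory Submission imports Defs begin

text \<open>The functor \<open>A(a,-) \<star> x\<close> is the free functor on the object \<open>x\<close> placed at \<open>a\<close>. Indeed, by the
  defining property of tensors, maps out of it into \<open>\<nu>\<close> are measured by
  \<open>\<And>\<^sub>b A(a,b) \<rightarrow> X(x, \<nu> b)\<close>, which is the object of natural transformations from the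
  representable \<open>A(a,-)\<close> to the \<open>\<V>\<close>-valued functor \<open>X(x, \<nu> -)\<close>; the Yoneda lemma
  (\<open>yoneda\<close>) evaluates it to \<open>X(x, \<nu> a)\<close>.

  The tensors have to come from completeness, which only provides infima. The tensor \<open>v \<star> x\<close>
  should corepresent \<open>y \<mapsto> v \<rightarrow> X(x,y)\<close>, and a corepresenting object is an infimum of the functor
  that it corepresents; conversely, the infimum of this particular functor does corepresent it
  (\<open>complete_has_tensors\<close>).

  The statements for \<open>\<iota>\<close> and \<open>\<iota>\<^sup>\<dagger>\<close> are the same statement for \<open>A\<close> and its opposite, so only
  \<open>\<iota>\<^sup>\<dagger>\<close> is treated.\<close>

lemma mult_mono_quantale:
  fixes a b c d :: "'v::comm_quantale"
  assumes "a \<le> b" "c \<le> d"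
  shows "a * c \<le> b * d"
proof -
  \<comment> \<open>Multiplication by a fixed element has a right adjoint, hence is monotone.\<close>
  have mono: "u * z \<le> w * z" if "u \<le> w" for u w z :: 'v
    using that qimp_adjoint order_refl order_trans by metis
  have "a * c \<le> b * c" using mono assms(1) .
  also have "\<dots> \<le> b * d" using mono[OF assms(2), of b] by (simp add: mult.commute)
  finally show ?thesis .
qed

lemma le_mult_left:
  fixes u v :: "'v::comm_quantale"
  assumes "1 \<le> u"
  shows "v \<le> u * v"
  using mult_mono_quantale[OF assms order_refl, of v] by simp

lemma qimp_eval:
  fixes u v :: "'v::comm_quantale"
  shows "u * (u \<rightharpoonup> v) \<le> v"
  using qimp_adjoint[of "u \<rightharpoonup> v" u v] by (simp add: mult.commute)

lemma hom_id: "vcategory X \<Longrightarrow> x \<in> obj X \<Longrightarrow> 1 \<le> hom X x x"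
  unfolding vcategory_def by blast

lemma hom_comp:
  "vcategory X \<Longrightarrow> x \<in> obj X \<Longrightarrow> y \<in> obj X \<Longrightarrow> z \<in> obj X \<Longrightarrow>
    hom X x y * hom X y z \<le> hom X x z"
  unfolding vcategory_def by blast

lemma obj_opp [simp]: "obj (opp X) = obj X"
  by (simp add: opp_def)

lemma hom_opp [simp]: "hom (opp X) x y = hom X y x"
  by (simp add: opp_def)

lemma vcategory_opp: "vcategory X \<Longrightarrow> vcategory (opp X)"
  unfolding vcategory_def by simp (metis mult.commute)

lemma vfunctorsD:
  assumes "f \<in> vfunctors X Y"
  shows "x \<in> obj X \<Longrightarrow> f x \<in> obj Y"
    and "x \<in> obj X \<Longrightarrow> y \<in> obj X \<Longrightarrow> hom X x y \<le> hom Y (f x) (f y)"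
  using assms unfolding vfunctors_def by auto

text \<open>The Yoneda lemma for \<open>\<V>\<close>-valued functors: testing at the identity of \<open>a\<close> bounds the infimum
  by \<open>g a\<close>, and functoriality of \<open>g\<close> says that no other index makes it smaller. Functoriality is
  only asked for on \<open>obj A\<close>, so that \<open>g\<close> may be given by a formula, without being made extensional.\<close>

lemma yoneda:
  fixes A :: "('a, 'v::comm_quantale) vcat"
  assumes A: "vcategory A" and a: "a \<in> obj A"
    and g: "\<And>b c. b \<in> obj A \<Longrightarrow> c \<in> obj A \<Longrightarrow> hom A b c \<le> g b \<rightharpoonup> g c"
  shows "(INF b\<in>obj A. hom A a b \<rightharpoonup> g b) = g a"
proof (rule antisym)
  have "(INF b\<in>obj A. hom A a b \<rightharpoonup> g b) \<le> hom A a a \<rightharpoonup> g a"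
    using a by (rule INF_lower)
  also have "\<dots> \<le> hom A a a * (hom A a a \<rightharpoonup> g a)"
    using hom_id[OF A a] by (rule le_mult_left)
  also have "\<dots> \<le> g a"
    by (rule qimp_eval)
  finally show "(INF b\<in>obj A. hom A a b \<rightharpoonup> g b) \<le> g a" .
next
  show "g a \<le> (INF b\<in>obj A. hom A a b \<rightharpoonup> g b)"
  proof (rule INF_greatest)
    fix b assume b: "b \<in> obj A"
    have "hom A a b * g a \<le> g b"
      using g[OF a b] by (simp add: qimp_adjoint)
    then show "g a \<le> hom A a b \<rightharpoonup> g b"
      by (simp add: qimp_adjoint[symmetric] mult.commute)
  qed
qed

text \<open>The universal property at \<open>t\<close> itself turns the identity of \<open>t\<close> into the unit of the tensor.\<close>

lemma tensor_unit:
  assumes X: "vcategory X" and t: "is_tensor X v x t"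
  shows "v \<le> hom X x t"
proof -
  have "t \<in> obj X" and "hom X t t = v \<rightharpoonup> hom X x t"
    using t unfolding is_tensor_def by auto
  then show ?thesis
    using hom_id[OF X, of t] by (simp add: qimp_adjoint[symmetric])
qed

text \<open>The tensor is the infimum \<open>t\<close> of the functor \<open>\<phi> y = v \<rightarrow> X(x,y)\<close> that it has to corepresent.
  The infimum property at \<open>t\<close> yields \<open>\<phi> y \<le> X(t,y)\<close>, since an infimum is a lower bound; the property at
  \<open>x\<close> yields \<open>v \<le> X(x,t)\<close>, from which \<open>X(t,y) \<le> \<phi> y\<close> follows by composition.\<close>

lemma complete_has_tensors:
  fixes X :: "('x, 'v::comm_quantale) vcat"
  assumes cX: "complete_vcategory X" and x: "x \<in> obj X"
  shows "\<exists>t. is_tensor X v x t"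
proof -
  have X: "vcategory X"
    using cX unfolding complete_vcategory_def by blast
  define \<phi> where "\<phi> = (\<lambda>y\<in>obj X. v \<rightharpoonup> hom X x y)"
  have \<phi>: "\<phi> y = v \<rightharpoonup> hom X x y" if "y \<in> obj X" for y
    using that by (simp add: \<phi>_def)
  have v\<phi>: "v * \<phi> y \<le> hom X x y" if "y \<in> obj X" for y
    using qimp_eval that by (simp add: \<phi>)
  have "hom X y z \<le> \<phi> y \<rightharpoonup> \<phi> z" if y: "y \<in> obj X" and z: "z \<in> obj X" for y z
  proof -
    have "v * \<phi> y * hom X y z \<le> hom X x y * hom X y z"
      using v\<phi>[OF y] order_refl by (rule mult_mono_quantale)
    also have "\<dots> \<le> hom X x z"
      using hom_comp[OF X x y z] .
    finally show ?thesis
      using z by (simp add: \<phi>[OF z] qimp_adjoint[symmetric] mult_ac)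
  qed
  then have "\<phi> \<in> obj (functor_vcat X self_vcat)"
    unfolding functor_vcat_def vfunctors_def self_vcat_def by (simp add: \<phi>_def)
  then obtain t where t: "is_infimum X \<phi> t"
    using cX unfolding complete_vcategory_def by blast
  then have tX: "t \<in> obj X"
    unfolding is_infimum_def by blast
  have inf: "hom X z t = (INF y\<in>obj X. \<phi> y \<rightharpoonup> hom X z y)" if "z \<in> obj X" for z
    using t that unfolding is_infimum_def by blast
  have vt: "v \<le> hom X x t"
    unfolding inf[OF x] by (rule INF_greatest) (simp add: qimp_adjoint[symmetric] v\<phi>)
  have "hom X t y = v \<rightharpoonup> hom X x y" if y: "y \<in> obj X" for y
  proof (rule antisym)
    have "v * hom X t y \<le> hom X x t * hom X t y"
      using vt order_refl by (rule mult_mono_quantale)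
    also have "\<dots> \<le> hom X x y"
      using hom_comp[OF X x tX y] .
    finally show "hom X t y \<le> v \<rightharpoonup> hom X x y"
      by (simp add: qimp_adjoint[symmetric] mult.commute)
    have "1 \<le> hom X t t"
      using hom_id[OF X tX] .
    also have "\<dots> \<le> \<phi> y \<rightharpoonup> hom X t y"
      unfolding inf[OF tX] using y by (rule INF_lower)
    finally show "v \<rightharpoonup> hom X x y \<le> hom X t y"
      by (simp add: qimp_adjoint[symmetric] \<phi>[OF y])
  qed
  then show ?thesis
    using tX unfolding is_tensor_def by blast
qed

lemma is_tensor_tensor:
  assumes "complete_vcategory X" and "x \<in> obj X"
  shows "is_tensor X v x (tensor X v x)"
  unfolding tensor_def using complete_has_tensors[OF assms] by (rule someI_ex)

text \<open>Under the adjunction defining the tensor, functoriality transposes to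
  \<open>A(a,b) \<otimes> A(b,c) \<le> X(x, A(a,c) \<star> x)\<close>: compose in \<open>A\<close>, then apply the unit.\<close>

lemma iota_dagger_vfunctor:
  assumes A: "vcategory A" and cX: "complete_vcategory X"
    and a: "a \<in> obj A" and x: "x \<in> obj X"
  shows "iota_dagger A X a x \<in> obj (functor_vcat A X)"
proof -
  have X: "vcategory X"
    using cX unfolding complete_vcategory_def by blast
  note ten = is_tensor_tensor[OF cX x]
  have T: "tensor X v x \<in> obj X" for v
    using ten unfolding is_tensor_def by blast
  have "hom A b c \<le> hom X (tensor X (hom A a b) x) (tensor X (hom A a c) x)"
    if b: "b \<in> obj A" and c: "c \<in> obj A" for b c
  proof -
    have "hom A a b * hom A b c \<le> hom A a c"
      using hom_comp[OF A a b c] .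
    also have "\<dots> \<le> hom X x (tensor X (hom A a c) x)"
      using X ten by (rule tensor_unit)
    finally have "hom A b c \<le> hom A a b \<rightharpoonup> hom X x (tensor X (hom A a c) x)"
      by (simp add: qimp_adjoint[symmetric] mult.commute)
    also have "\<dots> = hom X (tensor X (hom A a b) x) (tensor X (hom A a c) x)"
      using ten T unfolding is_tensor_def by simp
    finally show ?thesis .
  qed
  then show ?thesis
    unfolding functor_vcat_def vfunctors_def iota_dagger_def by (simp add: T)
qed

lemma hom_iota_dagger:
  assumes A: "vcategory A" and cX: "complete_vcategory X"
    and a: "a \<in> obj A" and x: "x \<in> obj X"
    and \<nu>: "\<nu> \<in> obj (functor_vcat A X)"
  shows "hom (functor_vcat A X) (iota_dagger A X a x) \<nu> = hom X x (\<nu> a)"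
proof -
  have X: "vcategory X"
    using cX unfolding complete_vcategory_def by blast
  have \<nu>f: "\<nu> \<in> vfunctors A X"
    using \<nu> unfolding functor_vcat_def by simp
  have "hom (functor_vcat A X) (iota_dagger A X a x) \<nu>
      = (INF b\<in>obj A. hom X (tensor X (hom A a b) x) (\<nu> b))"
    unfolding functor_vcat_def iota_dagger_def by simp
  also have "\<dots> = (INF b\<in>obj A. hom A a b \<rightharpoonup> hom X x (\<nu> b))"
    using is_tensor_tensor[OF cX x] vfunctorsD(1)[OF \<nu>f]
    unfolding is_tensor_def by simp
  also have "\<dots> = hom X x (\<nu> a)"
  proof (rule yoneda[OF A a])
    fix b c assume b: "b \<in> obj A" and c: "c \<in> obj A"
    have "hom X x (\<nu> b) * hom A b c \<le> hom X x (\<nu> b) * hom X (\<nu> b) (\<nu> c)"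
      using order_refl vfunctorsD(2)[OF \<nu>f b c] by (rule mult_mono_quantale)
    also have "\<dots> \<le> hom X x (\<nu> c)"
      using hom_comp[OF X x] vfunctorsD(1)[OF \<nu>f] b c by blast
    finally show "hom A b c \<le> hom X x (\<nu> b) \<rightharpoonup> hom X x (\<nu> c)"
      by (simp add: qimp_adjoint[symmetric] mult.commute)
  qed
  finally show ?thesis .
qed

lemma iota_eq_iota_dagger_opp: "iota A X a x = iota_dagger (opp A) X a x"
  unfolding iota_def iota_dagger_def by simp

theorem proposition4p8:
  fixes A :: "('a, 'v::comm_quantale) vcat" and X :: "('x, 'v) vcat"
  assumes "vcategory A" and "complete_vcategory X"
  shows "\<forall>a\<in>obj A. \<forall>x\<in>obj X.
    iota A X a x \<in> obj (functor_vcat (opp A) X) \<and>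
    iota_dagger A X a x \<in> obj (functor_vcat A X) \<and>
    (\<forall>\<mu>\<in>obj (functor_vcat (opp A) X).
      hom (functor_vcat (opp A) X) (iota A X a x) \<mu> = hom X x (\<mu> a)) \<and>
    (\<forall>\<nu>\<in>obj (functor_vcat A X).
      hom (opp (functor_vcat A X)) \<nu> (iota_dagger A X a x) = hom X x (\<nu> a))"
  using assms vcategory_opp[OF assms(1)]
  by (simp add: iota_eq_iota_dagger_opp iota_dagger_vfunctor hom_iota_dagger)

end
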